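(* Let $p$ be an odd prime and let $\mathbb{P}=\mathbb{C}_p[x]$. For every polynomial $q(x)\in\mathbb{P}$, $$\Big\langle \int_{\mathbb{Z}_p}e^{yt}\,d\mu_{-1}(y)\,\Big|\, q(x)\Big\rangle=\int_{\mathbb{Z}_p}q(u)\,d\mu_{-1}(u),$$ that is, $$\Big\langle \frac{2}{e^t+1}\,\Big|\, q(x)\Big\rangle=\int_{\mathbb{Z}_p}q(u)\,d\mu_{-1}(u).$$ Also, for every integer $n\ge 0$, the $n$-th Euler number is given by $$E_n=\Big\langle \int_{\mathbb{Z}_p}e^{yt}\,d\mu_{-1}(y)\,\Big|\, x^n\Big\rangle .$$
   Context: $p$ is a fixed odd prime; $\mathbb{Z}_p$ is the ring of $p$-adic integers and $\mathbb{C}_p$ is the completion of the algebraic closure of $\mathbb{Q}_p$. Fermionic $p$-adic integral: for a continuous function $f:\mathbb{Z}_p\to\mathbb{C}_p$, $$\int_{\mathbb{Z}_p}f(x)\,d\mu_{-1}(x)=\lim_{N\to\infty}\sum_{x=0}^{p^N-1}f(x)(-1)^x .$$ Umbral algebra: $\mathcal{F}$ is the algebra of formal power series $f(t)=\sum_{k\ge0}\frac{a_k}{k!}t^k$ with $a_k\in\mathbb{C}_p$. Each such $f(t)$ defines a linear functional on $\mathbb{P}=\mathbb{C}_p[x]$, written $\langle f(t)\,|\,q(x)\rangle$, determined by linearity and $\langle f(t)\,|\,x^n\rangle=a_n$ for all $n\ge0$. The symbol $\int_{\mathbb{Z}_p}e^{yt}\,d\mu_{-1}(y)$ denotes the formal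 power series $\sum_{k\ge0}\left(\int_{\mathbb{Z}_p}y^k\,d\mu_{-1}(y)\right)\frac{t^k}{k!}\in\mathcal{F}$. The statement includes the identification of this series with $\frac{2}{e^t+1}\in\mathcal{F}$, where $e^t=\sum_{k\ge0}t^k/k!$ and the quotient is taken in the ring of formal power series. Euler numbers $E_n$ are defined by $\frac{2}{e^t+1}=\sum_{n\ge0}E_n\frac{t^n}{n!}$. *)

theory Defs
  imports
    "HOL-Analysis.Elementary_Metric_Spaces"
    "HOL-Computational_Algebra.Computational_Algebra"
begin

text \<open>
  The field of \<open>p\<close>-adic complex numbers is the completion of an algebraic closure of the
  completion of the rationals at \<open>p\<close>.  It is treated here, up to isometric isomorphism,
  as a field type \<open>'a\<close> carrying a complete metric that is induced by an absolute value
  \<open>v\<close>.  Inside such a field, the \<open>p\<close>-adic numbers are the closure of the rationals.  (The class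
  \<open>real_normed_field\<close> cannot be used, since it provides a real scalar multiplication.)
\<close>

definition padic_abs_rat :: "nat \<Rightarrow> rat \<Rightarrow> real" where
  "padic_abs_rat p r =
     (if r = 0 then 0
      else real p powi (int (multiplicity (int p) (snd (quotient_of r)))
                        - int (multiplicity (int p) (fst (quotient_of r)))))"

definition padic_numbers :: "'a::{field_char_0, metric_space} set" where
  "padic_numbers = closure \<rat>"

definition padic_algebraic_numbers :: "'a::{field_char_0, metric_space} set" where
  "padic_algebraic_numbers =
     {z. \<exists>f. f \<noteq> 0 \<and> (\<forall>i. coeff f i \<in> padic_numbers) \<and> poly f z = 0}"

definition padic_integers :: "('a \<Rightarrow> real) \<Rightarrow> 'a::{field_char_0, metric_space} set" where
  "padic_integers v = {x \<in> padic_numbers. v x \<le> 1}"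

text \<open>Completeness of the field is part of the class \<open>complete_space\<close>.\<close>

locale padic_complex_field =
  fixes p :: nat
    and v :: "'a::{field_char_0, complete_space} \<Rightarrow> real"
  assumes dist_eq: "dist x y = v (x - y)"
    and v_mult: "v (x * y) = v x * v y"
    and v_ultrametric: "v (x + y) \<le> max (v x) (v y)"
    and v_of_rat: "v (of_rat r) = padic_abs_rat p r"
    and algebraically_closed:
      "(\<forall>i. coeff (f :: 'a poly) i \<in> padic_algebraic_numbers) \<Longrightarrow> 0 < degree f \<Longrightarrow>
       \<exists>z \<in> padic_algebraic_numbers. poly f z = 0"
    and algebraic_dense: "closure (padic_algebraic_numbers :: 'a set) = UNIV"

definition fermionic_sum :: "nat \<Rightarrow> ('a \<Rightarrow> 'a) \<Rightarrow> nat \<Rightarrow> 'a::{field_char_0, metric_space}" where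
  "fermionic_sum p f N = (\<Sum>x = 0..p ^ N - 1. f (of_nat x) * (-1) ^ x)"

text \<open>
  The integral is a limit, hence only meaningful when that limit exists.  A function
  on the \<open>p\<close>-adic integers is represented by any function on \<open>'a\<close> extending it; the values
  outside are irrelevant.
\<close>

definition fermionic_integrable ::
    "nat \<Rightarrow> ('a \<Rightarrow> real) \<Rightarrow> ('a \<Rightarrow> 'a::{field_char_0, metric_space}) \<Rightarrow> bool" where
  "fermionic_integrable p v f \<longleftrightarrow>
     continuous_on (padic_integers v) f \<and> convergent (fermionic_sum p f)"

definition fermionic_integral ::
    "nat \<Rightarrow> ('a \<Rightarrow> 'a) \<Rightarrow> 'a::{field_char_0, metric_space}" where
  "fermionic_integral p f = lim (fermionic_sum p f)"

text \<open>
  The functional of \<open>f = (\<Sum>k. a\<^sub>k / k! * t^k)\<close>, where \<open>a\<^sub>k = k! * fps_nth f k\<close>.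
  The three lemmas below show that it is the linear functional sending \<open>x^n\<close> to \<open>a\<^sub>n\<close>.
\<close>

definition umbral :: "'a::field_char_0 fps \<Rightarrow> 'a poly \<Rightarrow> 'a" where
  "umbral f q = (\<Sum>k\<le>degree q. coeff q k * (fact k * fps_nth f k))"

lemma umbral_eq_sum:
  assumes "degree q \<le> n"
  shows "umbral f q = (\<Sum>k\<le>n. coeff q k * (fact k * fps_nth f k))"
  unfolding umbral_def using assms
  by (intro sum.mono_neutral_left) (auto simp: coeff_eq_0)

lemma umbral_add: "umbral f (q + r) = umbral f q + umbral f r"
proof -
  define n where "n = max (degree q) (degree r)"
  have "degree q \<le> n" "degree r \<le> n" "degree (q + r) \<le> n"
    by (auto simp: n_def intro: degree_add_le)
  then show ?thesis
    by (simp add: umbral_eq_sum[where n = n] distrib_right sum.distrib)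
qed

lemma umbral_smult: "umbral f (smult c q) = c * umbral f q"
  by (simp add: umbral_eq_sum[OF degree_smult_le] umbral_def sum_distrib_left mult.assoc)

lemma umbral_monom: "umbral f (monom 1 n) = fact n * fps_nth f n"
proof -
  have "umbral f (monom 1 n) = (\<Sum>k\<le>n. if k = n then fact k * fps_nth f k else 0)"
    by (subst umbral_eq_sum[OF degree_monom_le]) (intro sum.cong, auto)
  then show ?thesis by simp
qed

text \<open>The formal power series denoted by the integral of \<open>e^(y t)\<close> with respect to \<open>y\<close>.\<close>

definition fermionic_exp_integral :: "nat \<Rightarrow> 'a::{field_char_0, metric_space} fps" where
  "fermionic_exp_integral p = Abs_fps (\<lambda>k. fermionic_integral p (\<lambda>y. y ^ k) / fact k)"

definition euler_gen :: "'a::field_char_0 fps" where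
  "euler_gen = 2 / (fps_exp 1 + 1)"

definition euler_number :: "nat \<Rightarrow> 'a::field_char_0" where
  "euler_number n = fact n * fps_nth euler_gen n"

lemma euler_number_generating_function:
  "2 / (fps_exp 1 + 1) = Abs_fps (\<lambda>n. euler_number n / fact n)"
  by (simp add: fps_eq_iff euler_number_def euler_gen_def)

end

theory Submission imports Defs begin

text \<open>
  For odd \<open>M\<close> the geometric series gives
  \<open>(\<Sum>x<M. (-1)^x e^(x t)) = (1 + e^(M t)) / (1 + e^t)\<close>.  Pairing both sides with a polynomial
  \<open>q\<close> turns the left-hand side into the fermionic sum of \<open>q\<close>, while the right-hand side becomes a
  polynomial expression in \<open>M\<close>.  Polynomials are \<open>p\<close>-adically continuous and \<open>M = p^N\<close> tends to
  \<open>0\<close>, so the sums converge to the pairing of \<open>q\<close> with \<open>(1 + e^0) / (1 + e^t)\<close>.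
\<close>

lemma umbral_fps_add: "umbral (f + g) q = umbral f q + umbral g q"
  by (simp add: umbral_def algebra_simps sum.distrib)

lemma umbral_fps_const_mult: "umbral (fps_const c * f) q = c * umbral f q"
  by (simp add: umbral_def sum_distrib_left mult_ac)

lemma umbral_fps_sum: "umbral (\<Sum>x\<in>A. f x) q = (\<Sum>x\<in>A. umbral (f x) q)"
proof -
  have "umbral 0 q = 0" by (simp add: umbral_def)
  then show ?thesis
    by (induction A rule: infinite_finite_induct) (simp_all add: umbral_fps_add)
qed

text \<open>The factorials in the pairing cancel those in the coefficients
  \<open>c ^ k / fact k\<close>, so e^(c t) acts as evaluation at \<open>c\<close>. This is what
  turns an alternating sum of exponentials into a fermionic sum.\<close>

lemma umbral_fps_exp: "umbral (fps_exp c) q = poly q c"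
  by (simp add: umbral_def poly_altdef)

text \<open>Each coefficient of g(t) e^(c t) is a polynomial in \<open>c\<close>, and the pairing
  with \<open>q\<close> involves only finitely many of them. Only the existence of \<open>R\<close>
  matters later: it reduces a limit in \<open>c\<close> to continuity of polynomials.\<close>

lemma umbral_mult_fps_exp_poly:
  fixes g :: "'a::field_char_0 fps"
  obtains R where "\<And>c. umbral (g * fps_exp c) q = poly R c"
proof
  fix c
  show "umbral (g * fps_exp c) q = poly (\<Sum>k\<le>degree q. smult (coeff q k * fact k)
          (\<Sum>i=0..k. monom (fps_nth g i / fact (k - i)) (k - i))) c"
    by (simp add: umbral_def fps_mult_nth poly_sum poly_monom mult.assoc)
qed

lemma alternating_fps_exp_sum:
  assumes "odd M"
  shows "(\<Sum>x<M. fps_const ((-1) ^ x) * fps_exp (of_nat x)) =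
    (1 + fps_exp (of_nat M)) * inverse (1 + fps_exp (1 :: 'a::field_char_0))"
proof -
  let ?E = "fps_exp (1 :: 'a)"
  have "(\<Sum>x<M. fps_const ((-1) ^ x) * fps_exp (of_nat x)) = (\<Sum>x<M. (- ?E) ^ x)"
  proof (rule sum.cong)
    fix x
    have "(- ?E) ^ x = (- 1) ^ x * ?E ^ x" by (rule power_minus)
    then show "fps_const ((-1) ^ x) * fps_exp (of_nat x) = (- ?E) ^ x"
      by (simp add: fps_exp_power_mult fps_const_power [symmetric] fps_const_neg [symmetric]
          del: fps_const_power fps_const_neg)
  qed simp
  \<comment> \<open>The constant term of \<open>1 + ?E\<close> is 2, which is nonzero in
    characteristic 0, so this series is a unit.\<close>
  also have "\<dots> = inverse (1 + ?E) * (1 + ?E) * (\<Sum>x<M. (- ?E) ^ x)"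
    by (subst inverse_mult_eq_1) simp_all
  also have "\<dots> = inverse (1 + ?E) * (1 - (- ?E) ^ M)"
    using one_diff_power_eq[of "- ?E" M] by (simp add: mult.assoc)
  \<comment> \<open>Oddness of \<open>M\<close> gives (-e^t)^M = -e^(M t), hence the plus
    sign.\<close>
  also have "\<dots> = (1 + fps_exp (of_nat M)) * inverse (1 + ?E)"
    using assms by (simp add: fps_exp_power_mult mult.commute)
  finally show ?thesis .
qed

lemma fermionic_sum_poly_eq_umbral:
  fixes q :: "'a::{field_char_0, metric_space} poly"
  assumes "odd p"
  shows "fermionic_sum p (poly q) N =
    umbral ((1 + fps_exp (of_nat (p ^ N))) * inverse (1 + fps_exp 1)) q"
proof -
  \<comment> \<open>Subtraction on \<open>nat\<close> is truncated, so the two index sets agree only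
    when \<open>p ^ N\<close> is positive.\<close>
  have "p ^ N > 0" using assms by (auto intro: odd_pos)
  then have "{0..p ^ N - 1} = {..<p ^ N}" 
    by (intro set_eqI, unfold atLeastAtMost_iff lessThan_iff) linarith
  then have "fermionic_sum p (poly q) N =
      umbral (\<Sum>x<p ^ N. fps_const ((-1) ^ x) * fps_exp (of_nat x)) q"
    by (simp add: fermionic_sum_def umbral_fps_sum umbral_fps_const_mult umbral_fps_exp
        mult.commute[of "poly q _"])
  then show ?thesis
    using assms by (subst (asm) alternating_fps_exp_sum) auto
qed

context padic_complex_field
begin

lemma v_eq_dist: "v x = dist x 0"
  by (simp add: dist_eq)

text \<open>The sort of \<open>'a\<close> does not relate the metric to the field operations;
  \<open>dist_eq\<close> does. Passing to real limits of \<open>v\<close> makes the continuity of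
  addition and multiplication provable.\<close>

lemma tendsto_v_iff:
  fixes f :: "'b \<Rightarrow> 'a"
  shows "(f \<longlongrightarrow> l) F \<longleftrightarrow> ((\<lambda>x. v (f x - l)) \<longlongrightarrow> 0) F"
  by (subst tendsto_dist_iff) (simp add: dist_eq)

lemma v_add_le: "v (x + y) \<le> v x + v y"
proof -
  have "v x \<ge> 0" "v y \<ge> 0" by (simp_all add: v_eq_dist)
  then show ?thesis using v_ultrametric[of x y] by linarith
qed

lemma v_tendsto_add:
  fixes f g :: "'b \<Rightarrow> 'a"
  assumes "(f \<longlongrightarrow> a) F" "(g \<longlongrightarrow> b) F"
  shows "((\<lambda>x. f x + g x) \<longlongrightarrow> a + b) F"
  unfolding tendsto_v_iff
proof (rule tendsto_sandwich[where f = "\<lambda>_. 0"])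
  show "((\<lambda>x. v (f x - a) + v (g x - b)) \<longlongrightarrow> 0) F"
    using assms by (auto simp: tendsto_v_iff intro: tendsto_add_zero)
  show "\<forall>\<^sub>F x in F. v (f x + g x - (a + b)) \<le> v (f x - a) + v (g x - b)"
    using v_add_le by (auto simp: add_diff_add)
qed (auto simp: v_eq_dist)

lemma v_tendsto_mult:
  fixes f g :: "'b \<Rightarrow> 'a"
  assumes "(f \<longlongrightarrow> a) F" "(g \<longlongrightarrow> b) F"
  shows "((\<lambda>x. f x * g x) \<longlongrightarrow> a * b) F"
  unfolding tendsto_v_iff
proof (rule tendsto_sandwich[where f = "\<lambda>_. 0"])
  \<comment> \<open>Expanding the product around the limits \<open>a\<close> and \<open>b\<close>
    leaves the product of the two errors and two cross terms; \<open>?h\<close> adds up their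
    absolute values.\<close>
  let ?h = "\<lambda>x. v (f x - a) * v (g x - b) + v a * v (g x - b) + v (f x - a) * v b"
  have "(?h \<longlongrightarrow> 0 * 0 + v a * 0 + 0 * v b) F"
    using assms by (intro tendsto_intros) (auto simp: tendsto_v_iff)
  then show "(?h \<longlongrightarrow> 0) F" by simp
  have "v (f x * g x - a * b) \<le> ?h x" for x
  proof -
    have "f x * g x - a * b = (f x - a) * (g x - b) + a * (g x - b) + (f x - a) * b"
      by (simp add: algebra_simps)
    then show ?thesis
      using v_add_le[of "(f x - a) * (g x - b) + a * (g x - b)" "(f x - a) * b"]
        v_add_le[of "(f x - a) * (g x - b)" "a * (g x - b)"]
      by (simp add: v_mult)
  qed
  then show "\<forall>\<^sub>F x in F. v (f x * g x - a * b) \<le> ?h x" by simp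
qed (auto simp: v_eq_dist)

lemma v_tendsto_poly:
  fixes f :: "'b \<Rightarrow> 'a"
  assumes "(f \<longlongrightarrow> a) F"
  shows "((\<lambda>x. poly q (f x)) \<longlongrightarrow> poly q a) F"
  by (induction q) (auto intro!: v_tendsto_add v_tendsto_mult assms)

lemma continuous_on_poly: "continuous_on A (poly (q :: 'a poly))"
  by (auto simp: continuous_on_def intro: v_tendsto_poly)

lemma v_of_nat_prime:
  assumes "prime p"
  shows "v (of_nat p) = 1 / real p"
proof -
  have "multiplicity (int p) (int p) = 1"
    using assms prime_gt_1_nat by (intro multiplicity_self) auto
  moreover have "v (of_nat p) = padic_abs_rat p (rat_of_int (int p))"
    by (simp flip: v_of_rat)
  ultimately show ?thesis
    using assms prime_gt_0_nat[of p]
    by (simp add: padic_abs_rat_def power_int_minus divide_inverse)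
qed

lemma prime_power_tendsto_zero:
  assumes "prime p"
  shows "(\<lambda>N. of_nat (p ^ N) :: 'a) \<longlonglongrightarrow> 0"
proof -
  \<comment> \<open>Multiplicativity makes \<open>v 1\<close> idempotent, and it is nonzero because
    1 and 0 have positive distance.\<close>
  have v_one: "v 1 = 1"
    using v_mult[of 1 1] dist_eq_0_iff[of "1 :: 'a" 0] by (simp add: v_eq_dist)
  have "v (of_nat (p ^ N)) = (1 / real p) ^ N" for N
    by (induction N) (simp_all add: v_one v_mult v_of_nat_prime[OF assms])
  moreover have "(\<lambda>N. (1 / real p) ^ N) \<longlonglongrightarrow> 0"
    using prime_gt_1_nat[OF assms] by (intro LIMSEQ_realpow_zero) auto
  ultimately show ?thesis
    by (simp add: tendsto_v_iff)
qed

lemma fermionic_sum_poly_tendsto: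
  fixes q :: "'a poly"
  assumes "prime p" "odd p"
  shows "fermionic_sum p (poly q) \<longlonglongrightarrow> umbral (2 / (fps_exp 1 + 1)) q"
proof -
  let ?g = "inverse (1 + fps_exp (1 :: 'a))"
  obtain R where R: "\<And>c. umbral (?g * fps_exp c) q = poly R c"
    using umbral_mult_fps_exp_poly by blast
  have sum_eq: "fermionic_sum p (poly q) =
      (\<lambda>N. poly ([:umbral ?g q:] + R) (of_nat (p ^ N)))"
    by (rule ext) (simp add: fermionic_sum_poly_eq_umbral assms umbral_fps_add
        R distrib_left mult.commute[of _ ?g] del: of_nat_power)
  \<comment> \<open>At c = 0 the factor e^(c t) is 1, so both summands contribute the pairing with
    \<open>?g\<close>; this doubling is the numerator 2.\<close>
  have "poly R 0 = umbral ?g q"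
    using R[of 0] by simp
  moreover have "(2 :: 'a fps) / (fps_exp 1 + 1) = ?g + ?g"
    by (simp add: fps_divide_unit add.commute)
  ultimately have "poly ([:umbral ?g q:] + R) 0 = umbral (2 / (fps_exp 1 + 1)) q"
    by (simp only: umbral_fps_add poly_add poly_pCons poly_0 mult_zero_left add_0_right)
  then show ?thesis
    unfolding sum_eq
    using v_tendsto_poly[OF prime_power_tendsto_zero[OF assms(1)], of "[:umbral ?g q:] + R"]
    by simp
qed

end

theorem theorem2p1:
  fixes p :: nat
    and v :: "'a::{field_char_0, complete_space} \<Rightarrow> real"
  assumes "prime p" and "odd p"
    and "padic_complex_field p v"
  shows "(\<forall>q :: 'a poly. fermionic_integrable p v (poly q)) \<and>
    (fermionic_exp_integral p :: 'a fps) = 2 / (fps_exp 1 + 1) \<and>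
    (\<forall>q :: 'a poly.
       umbral (fermionic_exp_integral p) q = fermionic_integral p (poly q)) \<and>
    (\<forall>q :: 'a poly.
       umbral (2 / (fps_exp 1 + 1)) q = fermionic_integral p (poly q)) \<and>
    (\<forall>n. (euler_number n :: 'a) = umbral (fermionic_exp_integral p) (monom 1 n))"
proof -
  interpret padic_complex_field p v by fact
  note lim = fermionic_sum_poly_tendsto[OF assms(1,2)]
  have integrable: "fermionic_integrable p v (poly q)" for q :: "'a poly"
    using lim[of q] continuous_on_poly by (auto simp: fermionic_integrable_def convergent_def)
  have integral: "umbral (2 / (fps_exp 1 + 1)) q = fermionic_integral p (poly q)"
    for q :: "'a poly"
    using limI[OF lim[of q]] by (simp add: fermionic_integral_def)
  \<comment> \<open>Taking q = x^n in \<open>integral\<close> computes every moment, which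
    identifies the two series coefficient by coefficient.\<close>
  have "fermionic_integral p (\<lambda>y. y ^ n) = fact n * fps_nth (2 / (fps_exp (1 :: 'a) + 1)) n" for n
  proof -
    have "(\<lambda>y :: 'a. y ^ n) = poly (monom 1 n)"
      by (simp add: fun_eq_iff poly_monom)
    then show ?thesis
      using integral[of "monom 1 n"] by (simp add: umbral_monom)
  qed
  then have gen: "(fermionic_exp_integral p :: 'a fps) = 2 / (fps_exp 1 + 1)"
    by (simp add: fermionic_exp_integral_def fps_eq_iff)
  show ?thesis
    using integrable integral by (simp add: gen umbral_monom euler_number_def euler_gen_def)
qed

end
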